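(* Let $d\in\{1,2,3\}$ and consider a sequence of space-time discretizations obtained by uniform refinement in temporal and spatial direction, with $N_t$ temporal unknowns, $m$ spatial unknowns and $\mathrm{dof}=N_t\cdot m$, so that $N_t\sim m^{1/d}\sim\mathrm{dof}^{1/(d+1)}$. Consider a space-time solver (the Bartels-Stewart method with real-Schur decomposition, the Bartels-Stewart method with complex-Schur decomposition, or the Fast Diagonalization method) whose overall computational cost and memory consumption are $$\mathcal{O}\bigl(N_t^3+mN_t^2+C_C(m)N_t\bigr)\quad\text{and}\quad\mathcal{O}\bigl(N_t^2+mN_t+C_S(m)\bigr),$$ where the spatial subproblems are solved by a sparse direct solver on structured grids. Then the computational cost is $\mathcal{O}(\mathrm{dof}^{3/2})$ for $d=1$, $\mathcal{O}(\mathrm{dof}^{4/3})$ for $d=2$, and $\mathcal{O}(\mathrm{dof}^{7/4})$ for $d=3$; and the memory consumption is $\mathcal{O}(\mathrm{dof})$ for $d=1,2,3$.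
   Context: The three solvers are direct methods for the linear system $(A_t\otimes M_x+M_t\otimes A_x)u=F$ with temporal matrices $A_t,M_t\in\mathbb{R}^{N_t\times N_t}$ and spatial finite element mass and stiffness matrices $M_x,A_x\in\mathbb{R}^{m\times m}$ on a domain in $\mathbb{R}^d$. They decompose $A_t^{-1}M_t$ as $X_tZ_tX_t^{-1}$, where $Z_t$ is, respectively, real upper quasi-triangular with $X_t$ orthogonal (real-Schur), complex upper triangular with $X_t$ unitary (complex-Schur), or complex diagonal (Fast Diagonalization). They then solve a sequence of spatial linear systems (with matrices such as $M_x+\lambda A_x$, or real $2\times2$ block versions of these). The functions $C_C(m)$ and $C_S(m)$ denote the operation count and storage for solving one such spatial linear system. Sparse direct solver on structured grids: for a sparse system with $n$ unknowns, the ordering and factorization steps cost $\mathcal{O}(n)$, $\mathcal{O}(n^{3/2})$, $\mathcal{O}(n^2)$ operations for $d=1,2,3$ respectively; the solving step costs $\mathcal{O}(n)$, $\mathcal{O}(n\ln n)$, $\mathcal{O}(n^{4/3})$ operations; and the memory is $\mathcal{O}(n)$, $\mathcal{O}(n\ln n)$, $\mathcal{O}(n^{4/3})$. Hence $C_C(m)$ is $\mathcal{O}(m)$, $\mathcal{O}(m^{3/2})$, $\mathcal{O}(m^2)$ and $C_S(m)$ is $\mathcal{O}(m)$, $\mathcal{O}(m\ln m)$, $\mathcal{O}(m^{4/3})$ for $d=1,2,3$. Uniform refinement means that in each refinement step $N_t$ doubles and $m$ grows by a factor $\mathcal{O}(2^d)$; $a\sim b$ means that $a/b$ is bounded above and below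 by positive constants along the sequence. *)

theory Defs
  imports Complex_Main "HOL-Library.Landau_Symbols"
begin

text \<open>Discretizations are indexed by the refinement level \<open>k :: nat\<close>; all Landau symbols are taken for
  \<open>k \<rightarrow> \<infinity>\<close>, respectively for the number of unknowns tending to infinity.\<close>

definition comparable :: "(nat \<Rightarrow> real) \<Rightarrow> (nat \<Rightarrow> real) \<Rightarrow> bool" where
  "comparable a b \<longleftrightarrow>
     (\<exists>c C. 0 < c \<and> 0 < C \<and> (\<forall>k. c \<le> a k / b k \<and> a k / b k \<le> C))"

definition dof :: "(nat \<Rightarrow> nat) \<Rightarrow> (nat \<Rightarrow> nat) \<Rightarrow> nat \<Rightarrow> nat" where
  "dof Nt m k = Nt k * m k"

text \<open>The one-sided growth condition on \<open>m\<close> does not by itself force \<open>Nt \<sim> m^(1/d)\<close>, so the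
  two comparability relations are part of the definition.\<close>

definition uniform_refinement :: "nat \<Rightarrow> (nat \<Rightarrow> nat) \<Rightarrow> (nat \<Rightarrow> nat) \<Rightarrow> bool" where
  "uniform_refinement d Nt m \<longleftrightarrow>
     (\<forall>k. 0 < Nt k \<and> 0 < m k) \<and>
     (\<forall>k. Nt (Suc k) = 2 * Nt k) \<and>
     (\<exists>C>0. \<forall>k. real (m (Suc k)) \<le> C * 2 ^ d * real (m k)) \<and>
     comparable (\<lambda>k. real (Nt k)) (\<lambda>k. real (m k) powr (1 / real d)) \<and>
     comparable (\<lambda>k. real (m k) powr (1 / real d))
                (\<lambda>k. real (dof Nt m k) powr (1 / real (d + 1)))"

text \<open>Costs of a sparse direct solver as functions of the number \<open>n\<close> of unknowns:
  operations for ordering and factorization, operations for the solving step, and memory.\<close>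

record sparse_direct_solver =
  factor_ops :: "nat \<Rightarrow> real"
  solve_ops :: "nat \<Rightarrow> real"
  factor_memory :: "nat \<Rightarrow> real"

definition on_structured_grids :: "nat \<Rightarrow> sparse_direct_solver \<Rightarrow> bool" where
  "on_structured_grids d S \<longleftrightarrow>
     (d = 1 \<longrightarrow> factor_ops S \<in> O(\<lambda>n. real n) \<and>
                solve_ops S \<in> O(\<lambda>n. real n) \<and>
                factor_memory S \<in> O(\<lambda>n. real n)) \<and>
     (d = 2 \<longrightarrow> factor_ops S \<in> O(\<lambda>n. real n powr (3/2)) \<and>
                solve_ops S \<in> O(\<lambda>n. real n * ln (real n)) \<and>
                factor_memory S \<in> O(\<lambda>n. real n * ln (real n))) \<and>
     (d = 3 \<longrightarrow> factor_ops S \<in> O(\<lambda>n. real n ^ 2) \<and>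
                solve_ops S \<in> O(\<lambda>n. real n powr (4/3)) \<and>
                factor_memory S \<in> O(\<lambda>n. real n powr (4/3)))"

datatype space_time_solver =
    Bartels_Stewart_Real_Schur
  | Bartels_Stewart_Complex_Schur
  | Fast_Diagonalization

text \<open>Sizes of the diagonal blocks of \<open>Z\<^sub>t\<close>: a block of size \<open>b\<close> leads to a spatial linear system
  with \<open>b * m\<close> unknowns. The real Schur form is only quasi-triangular, hence also has real
  \<open>2 \<times> 2\<close> blocks.\<close>

fun block_sizes :: "space_time_solver \<Rightarrow> nat set" where
  "block_sizes Bartels_Stewart_Real_Schur = {1, 2}"
| "block_sizes Bartels_Stewart_Complex_Schur = {1}"
| "block_sizes Fast_Diagonalization = {1}"

text \<open>The functions \<open>C\<^sub>C(m)\<close> and \<open>C\<^sub>S(m)\<close>, i.e. the operation count and storage for one spatial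
  linear system (the most expensive one occurring).\<close>

definition C_C :: "space_time_solver \<Rightarrow> sparse_direct_solver \<Rightarrow> nat \<Rightarrow> real" where
  "C_C T S m = Max ((\<lambda>b. factor_ops S (b * m) + solve_ops S (b * m)) ` block_sizes T)"

definition C_S :: "space_time_solver \<Rightarrow> sparse_direct_solver \<Rightarrow> nat \<Rightarrow> real" where
  "C_S T S m = Max ((\<lambda>b. factor_memory S (b * m)) ` block_sizes T)"

end

theory Submission
  imports Defs "HOL-Real_Asymp.Real_Asymp"
begin

text \<open>Everything is expressed in powers of \<open>m\<close>: \<open>N\<^sub>t\<close> is of order \<open>m\<^bsup>1/d\<^esup>\<close> and \<open>dof\<close> of order
  \<open>m\<^bsup>1+1/d\<^esup>\<close>, so each cost or memory term is bounded by \<open>dof\<^bsup>q\<^esup>\<close> as soon as its exponent in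
  \<open>m\<close> is at most \<open>q (1 + 1/d)\<close>. The constant factor 2 in the size of the real \<open>2 \<times> 2\<close> block
  systems is harmless because the solver costs are bounded by powers.\<close>

text \<open>The maximum of a finite nonempty family is one of its members, so its absolute value is
  at most the sum of all absolute values, whatever the signs. This handles the maxima over
  \<open>block_sizes T\<close> in \<open>C_C\<close> and \<open>C_S\<close>.\<close>

lemma Max_in_bigo:
  fixes f :: "'b \<Rightarrow> 'a \<Rightarrow> real"
  assumes "finite B" "B \<noteq> {}" and f: "\<And>b. b \<in> B \<Longrightarrow> f b \<in> O[F](g)"
  shows "(\<lambda>x. Max ((\<lambda>b. f b x) ` B)) \<in> O[F](g)"
proof -
  have "\<bar>Max ((\<lambda>b. f b x) ` B)\<bar> \<le> (\<Sum>b\<in>B. \<bar>f b x\<bar>)" for x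
  proof -
    have "Max ((\<lambda>b. f b x) ` B) \<in> (\<lambda>b. f b x) ` B"
      using assms(1,2) by (intro Max_in) auto
    then obtain b where "b \<in> B" "Max ((\<lambda>b. f b x) ` B) = f b x"
      by auto
    then show ?thesis
      using member_le_sum[of b B "\<lambda>b. \<bar>f b x\<bar>"] assms(1) by simp
  qed
  then have "(\<lambda>x. Max ((\<lambda>b. f b x) ` B)) \<in> O[F](\<lambda>x. \<Sum>b\<in>B. \<bar>f b x\<bar>)"
    by (intro landau_o.big_mono always_eventually allI) (auto intro: order_trans)
  also have "(\<lambda>x. \<Sum>b\<in>B. \<bar>f b x\<bar>) \<in> O[F](g)"
    using f by (intro big_sum_in_bigo) simp_all
  finally show ?thesis .
qed

text \<open>Since \<open>b * m k\<close> tends to infinity, the bound on \<open>f\<close> can be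
  evaluated there, and the factor \<open>b powr p\<close> that splits off is a constant.\<close>

lemma bigo_powr_scaled_compose:
  fixes f :: "nat \<Rightarrow> real" and m :: "nat \<Rightarrow> nat"
  assumes f: "f \<in> O(\<lambda>n. real n powr p)" and m: "filterlim m at_top at_top" and "0 < b"
  shows "(\<lambda>k. f (b * m k)) \<in> O(\<lambda>k. real (m k) powr p)"
proof -
  have "filterlim (\<lambda>k. b * m k) at_top at_top"
    using \<open>0 < b\<close> by (intro filterlim_at_top_mono[OF m]) auto
  then have "(\<lambda>k. f (b * m k)) \<in> O(\<lambda>k. real (b * m k) powr p)"
    by (rule landau_o.big.compose[OF f])
  also have "(\<lambda>k. real (b * m k) powr p) \<in> O(\<lambda>k. real (m k) powr p)"
    using \<open>0 < b\<close> by (simp add: powr_mult)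
  finally show ?thesis .
qed

lemma finite_block_sizes: "finite (block_sizes T)"
  and block_sizes_nonempty: "block_sizes T \<noteq> {}"
  and block_sizes_pos: "b \<in> block_sizes T \<Longrightarrow> 0 < b"
  by (cases T; auto)+

lemma C_C_bigo:
  fixes m :: "nat \<Rightarrow> nat"
  assumes "factor_ops S \<in> O(\<lambda>n. real n powr p)" "solve_ops S \<in> O(\<lambda>n. real n powr p)"
    and "filterlim m at_top at_top"
  shows "(\<lambda>k. C_C T S (m k)) \<in> O(\<lambda>k. real (m k) powr p)"
  unfolding C_C_def
  by (intro Max_in_bigo finite_block_sizes block_sizes_nonempty sum_in_bigo
      bigo_powr_scaled_compose assms block_sizes_pos)

lemma C_S_bigo:
  fixes m :: "nat \<Rightarrow> nat"
  assumes "factor_memory S \<in> O(\<lambda>n. real n powr p)" "filterlim m at_top at_top"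
  shows "(\<lambda>k. C_S T S (m k)) \<in> O(\<lambda>k. real (m k) powr p)"
  unfolding C_S_def
  by (intro Max_in_bigo finite_block_sizes block_sizes_nonempty
      bigo_powr_scaled_compose assms block_sizes_pos)

text \<open>As division by zero yields 0, the lower bound \<open>c > 0\<close> excludes zeros of
  \<open>b\<close> and makes all quotients positive. Hence the two bounds can be multiplied by the
  absolute value of \<open>b k\<close>, whatever its sign.\<close>

lemma comparable_bigtheta:
  assumes "comparable a b"
  shows "a \<in> \<Theta>(b)"
proof -
  obtain c C where cC: "0 < c" "0 < C" "\<And>k. c \<le> a k / b k" "\<And>k. a k / b k \<le> C"
    using assms by (auto simp: comparable_def)
  have nz: "b k \<noteq> 0" for k
    using cC(1) cC(3)[of k] by auto
  have q: "\<bar>a k\<bar> = a k / b k * \<bar>b k\<bar>" for k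
  proof -
    have "\<bar>a k\<bar> = \<bar>a k / b k\<bar> * \<bar>b k\<bar>"
      using nz[of k] by (simp add: abs_divide)
    then show ?thesis
      using cC(1) cC(3)[of k] by (simp only: abs_of_nonneg)
  qed
  show ?thesis
  proof (rule bigthetaI')
    show "\<forall>\<^sub>F k in sequentially. c * norm (b k) \<le> norm (a k) \<and> norm (a k) \<le> C * norm (b k)"
      unfolding real_norm_def q using cC(3,4)
      by (intro always_eventually allI conjI mult_right_mono) simp_all
  qed fact+
qed

lemma uniform_refinement_pos:
  assumes "uniform_refinement d Nt m"
  shows "0 < Nt k" "0 < m k"
  using assms by (auto simp: uniform_refinement_def)

lemma uniform_refinement_Nt:
  assumes "uniform_refinement d Nt m"
  shows "(\<lambda>k. real (Nt k)) \<in> \<Theta>(\<lambda>k. real (m k) powr (1 / real d))"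
  using assms by (intro comparable_bigtheta) (simp add: uniform_refinement_def)

text \<open>Doubling drives \<open>Nt\<close> to infinity, and comparability passes this on to
  \<open>m powr (1/d)\<close> and then to \<open>m\<close>. The solver costs are only known
  asymptotically, so this limit is what allows evaluating them along the refinement
  sequence.\<close>

lemma uniform_refinement_filterlim_m:
  assumes "uniform_refinement d Nt m" "0 < d"
  shows "filterlim m at_top at_top"
proof -
  have double: "Nt (Suc k) = 2 * Nt k" for k
    using assms(1) by (simp add: uniform_refinement_def)
  have Nt: "Nt k = 2 ^ k * Nt 0" for k
    by (induction k) (simp_all add: double)
  have "k \<le> Nt k" for k
    unfolding Nt[of k] using uniform_refinement_pos(1)[OF assms(1), of 0] less_exp[of k]
      mult_le_mono[of k "2 ^ k" 1 "Nt 0"] by simp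
  then have "filterlim Nt at_top at_top"
    by (intro filterlim_at_top_mono[OF filterlim_ident]) auto
  then have lim: "filterlim (\<lambda>k. real (Nt k)) at_top at_top"
    by (rule filterlim_compose[OF filterlim_real_sequentially])
  obtain C where C: "0 < C" "\<And>k. real (Nt k) / real (m k) powr (1 / real d) \<le> C"
    using assms(1) unfolding uniform_refinement_def comparable_def by blast
  have le: "real (Nt k) / C \<le> real (m k) powr (1 / real d)" for k
    using C(1) C(2)[of k] uniform_refinement_pos(2)[OF assms(1), of k]
    by (simp add: field_simps)
  have "filterlim (\<lambda>k. real (Nt k) / C) at_top at_top"
    using filterlim_tendsto_pos_mult_at_top[OF tendsto_const[of "1 / C"] _ lim] C(1) by simp
  then have "filterlim (\<lambda>k. real (m k) powr (1 / real d)) at_top at_top"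
    by (rule filterlim_at_top_mono) (simp add: le)
  \<comment> \<open>With \<open>m k\<close> at least 1 and \<open>1/d\<close> at most 1, the root
    lies below \<open>m k\<close> itself, so divergence of the root suffices.\<close>
  moreover have "\<forall>\<^sub>F k in sequentially. real (m k) powr (1 / real d) \<le> real (m k)"
  proof (intro always_eventually allI)
    fix k
    show "real (m k) powr (1 / real d) \<le> real (m k)"
      using powr_mono[of "1 / real d" 1 "real (m k)"]
        uniform_refinement_pos(2)[OF assms(1), of k] assms(2) by simp
  qed
  ultimately have "filterlim (\<lambda>k. real (m k)) at_top at_top"
    by (rule filterlim_at_top_mono)
  then show ?thesis
    by (simp add: filterlim_sequentially_iff_filterlim_real)
qed

lemma uniform_refinement_dof:
  assumes "uniform_refinement d Nt m"
  shows "(\<lambda>k. real (dof Nt m k)) \<in> \<Theta>(\<lambda>k. real (m k) powr (1 + 1 / real d))"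
proof -
  have "(\<lambda>k. real (Nt k) * real (m k)) \<in> \<Theta>(\<lambda>k. real (m k) powr (1 / real d) * real (m k))"
    by (intro landau_theta.mult uniform_refinement_Nt[OF assms] bigtheta_refl)
  then show ?thesis
    by (simp add: dof_def powr_add mult.commute)
qed

text \<open>Because \<open>m k\<close> is at least 1, its powers are monotone in the exponent, and
  \<open>dof powr q\<close> has order \<open>m powr (q * (1 + 1/d))\<close>.\<close>

lemma powr_m_bigo_dof:
  assumes "uniform_refinement d Nt m" and "p \<le> q * (1 + 1 / real d)"
  shows "(\<lambda>k. real (m k) powr p) \<in> O(\<lambda>k. real (dof Nt m k) powr q)"
proof -
  have "(\<lambda>k. real (m k) powr p) \<in> O(\<lambda>k. (real (m k) powr (1 + 1 / real d)) powr q)"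
  proof (intro landau_o.big_mono always_eventually allI)
    fix k
    show "norm (real (m k) powr p) \<le> norm ((real (m k) powr (1 + 1 / real d)) powr q)"
      using powr_mono[of p "q * (1 + 1 / real d)" "real (m k)"]
        uniform_refinement_pos(2)[OF assms(1), of k] assms(2)
      by (simp add: powr_powr mult.commute)
  qed
  also have "(\<lambda>k. (real (m k) powr (1 + 1 / real d)) powr q) \<in> \<Theta>(\<lambda>k. real (dof Nt m k) powr q)"
    using bigtheta_powr[OF iffD1[OF bigtheta_sym uniform_refinement_dof[OF assms(1)]], of q]
    by simp
  finally show ?thesis .
qed

lemma Nt_power_bigo_dof:
  assumes "uniform_refinement d Nt m" and "real j + real i / real d \<le> q * (1 + 1 / real d)"
  shows "(\<lambda>k. real (m k) ^ j * real (Nt k) ^ i) \<in> O(\<lambda>k. real (dof Nt m k) powr q)"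
proof -
  have "(\<lambda>k. real (m k) ^ j * real (Nt k) ^ i)
      \<in> O(\<lambda>k. real (m k) ^ j * (real (m k) powr (1 / real d)) ^ i)"
    using uniform_refinement_Nt[OF assms(1)]
    by (intro landau_o.big.mult landau_o.big_power bigthetaD1) simp_all
  \<comment> \<open>Positivity of \<open>m k\<close> matters here: \<open>0 ^ 0\<close> is 1, but
    \<open>0 powr 0\<close> is 0.\<close>
  also have "(\<lambda>k. real (m k) ^ j * (real (m k) powr (1 / real d)) ^ i)
      = (\<lambda>k. real (m k) powr (real j + real i / real d))"
    using uniform_refinement_pos(2)[OF assms(1)]
    by (simp add: powr_add powr_realpow powr_power)
  also have "\<dots> \<in> O(\<lambda>k. real (dof Nt m k) powr q)"
    by (rule powr_m_bigo_dof[OF assms])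
  finally show ?thesis .
qed

text \<open>The last three hypotheses compare the exponents in \<open>m\<close> of the three cost
  terms, in order, with that of \<open>dof powr q\<close>. A single \<open>p\<close> covers
  factorization and solving.\<close>

lemma cost_bigo_dof:
  assumes ref: "uniform_refinement d Nt m" and "0 < d"
    and fac: "factor_ops S \<in> O(\<lambda>n. real n powr p)" and sol: "solve_ops S \<in> O(\<lambda>n. real n powr p)"
    and cost: "cost \<in> O(\<lambda>k. real (Nt k) ^ 3 + real (m k) * real (Nt k) ^ 2
                        + C_C T S (m k) * real (Nt k))"
    and "3 / real d \<le> q * (1 + 1 / real d)" "1 + 2 / real d \<le> q * (1 + 1 / real d)"
    and "p + 1 / real d \<le> q * (1 + 1 / real d)"
  shows "cost \<in> O(\<lambda>k. real (dof Nt m k) powr q)"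
proof -
  note cost
  also have "(\<lambda>k. real (Nt k) ^ 3 + real (m k) * real (Nt k) ^ 2 + C_C T S (m k) * real (Nt k))
      \<in> O(\<lambda>k. real (dof Nt m k) powr q)"
  proof (intro sum_in_bigo)
    show "(\<lambda>k. real (Nt k) ^ 3) \<in> O(\<lambda>k. real (dof Nt m k) powr q)"
      using Nt_power_bigo_dof[OF ref, of 0 3 q] assms by simp
    show "(\<lambda>k. real (m k) * real (Nt k) ^ 2) \<in> O(\<lambda>k. real (dof Nt m k) powr q)"
      using Nt_power_bigo_dof[OF ref, of 1 2 q] assms by simp
    have "(\<lambda>k. C_C T S (m k) * real (Nt k))
        \<in> O(\<lambda>k. real (m k) powr p * real (m k) powr (1 / real d))"
      using uniform_refinement_Nt[OF ref]
      by (intro landau_o.big.mult C_C_bigo fac sol uniform_refinement_filterlim_m[OF ref \<open>0 < d\<close>]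
          bigthetaD1)
    also have "(\<lambda>k. real (m k) powr p * real (m k) powr (1 / real d))
        \<in> O(\<lambda>k. real (dof Nt m k) powr q)"
      using powr_m_bigo_dof[OF ref assms(8)] by (simp add: powr_add)
    finally show "(\<lambda>k. C_C T S (m k) * real (Nt k)) \<in> O(\<lambda>k. real (dof Nt m k) powr q)" .
  qed
  finally show ?thesis .
qed

text \<open>The exponent \<open>1 + 1/d\<close> is the order of \<open>dof\<close> itself in powers
  of \<open>m\<close>: it equals 2, 3/2, 4/3 for \<open>d\<close> = 1, 2, 3, which leaves room for
  the logarithm when \<open>d = 2\<close>.\<close>

lemma memory_bigo_dof:
  assumes ref: "uniform_refinement d Nt m" and "0 < d"
    and mem: "factor_memory S \<in> O(\<lambda>n. real n powr (1 + 1 / real d))"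
    and memory: "memory \<in> O(\<lambda>k. real (Nt k) ^ 2 + real (m k) * real (Nt k) + C_S T S (m k))"
  shows "memory \<in> O(\<lambda>k. real (dof Nt m k))"
proof -
  note memory
  also have "(\<lambda>k. real (Nt k) ^ 2 + real (m k) * real (Nt k) + C_S T S (m k))
      \<in> O(\<lambda>k. real (dof Nt m k))"
  proof (intro sum_in_bigo)
    have "2 / real d \<le> 1 + 1 / real d"
      using \<open>0 < d\<close> by (simp add: field_simps)
    then show "(\<lambda>k. real (Nt k) ^ 2) \<in> O(\<lambda>k. real (dof Nt m k))"
      using Nt_power_bigo_dof[OF ref, of 0 2 1] by simp
    show "(\<lambda>k. real (m k) * real (Nt k)) \<in> O(\<lambda>k. real (dof Nt m k))"
      by (simp add: dof_def mult.commute)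
    have "(\<lambda>k. C_S T S (m k)) \<in> O(\<lambda>k. real (m k) powr (1 + 1 / real d))"
      by (intro C_S_bigo mem uniform_refinement_filterlim_m[OF ref \<open>0 < d\<close>])
    also have "\<dots> = O(\<lambda>k. real (dof Nt m k))"
      using uniform_refinement_dof[OF ref] by (simp add: landau_o.big.cong_bigtheta)
    finally show "(\<lambda>k. C_S T S (m k)) \<in> O(\<lambda>k. real (dof Nt m k))" .
  qed
  finally show ?thesis .
qed

theorem mainTheorem4:
  fixes d :: nat and Nt m :: "nat \<Rightarrow> nat"
    and T :: space_time_solver and S :: sparse_direct_solver
    and cost memory :: "nat \<Rightarrow> real"
  assumes "d \<in> {1, 2, 3}"
    and "uniform_refinement d Nt m"
    and "on_structured_grids d S"
    and "cost \<in> O(\<lambda>k. real (Nt k) ^ 3 + real (m k) * real (Nt k) ^ 2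
                        + C_C T S (m k) * real (Nt k))"
    and "memory \<in> O(\<lambda>k. real (Nt k) ^ 2 + real (m k) * real (Nt k) + C_S T S (m k))"
  shows "(d = 1 \<longrightarrow> cost \<in> O(\<lambda>k. real (dof Nt m k) powr (3/2))) \<and>
         (d = 2 \<longrightarrow> cost \<in> O(\<lambda>k. real (dof Nt m k) powr (4/3))) \<and>
         (d = 3 \<longrightarrow> cost \<in> O(\<lambda>k. real (dof Nt m k) powr (7/4))) \<and>
         memory \<in> O(\<lambda>k. real (dof Nt m k))"
proof -
  note grids = assms(3)[unfolded on_structured_grids_def]
  consider "d = 1" | "d = 2" | "d = 3"
    using assms(1) by auto
  then show ?thesis
  proof cases
    case 1
    \<comment> \<open>For \<open>d = 1\<close> the memory lemma asks only for exponent 2, so linear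
      solver memory is weakened to it.\<close>
    have lin: "real \<in> O(\<lambda>n. real n ^ 2)"
      by real_asymp
    \<comment> \<open>The exponents in \<open>m\<close> are 3, 3 and 2, against
      \<open>3/2 * 2 = 3\<close>: the first two terms are critical.\<close>
    have "cost \<in> O(\<lambda>k. real (dof Nt m k) powr (3/2))"
      using grids 1 by (intro cost_bigo_dof[OF assms(2) _ _ _ assms(4), where p = 1]) auto
    moreover have "memory \<in> O(\<lambda>k. real (dof Nt m k))"
      using grids 1 by (intro memory_bigo_dof[OF assms(2) _ _ assms(5)])
        (auto intro: landau_o.big_trans lin)
    ultimately show ?thesis
      using 1 by simp
  next
    case 2
    \<comment> \<open>The exponent 3/2 serves twice: as the factorization exponent \<open>p\<close>
      and as the memory exponent \<open>1 + 1/2\<close>.\<close>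
    have nlogn: "(\<lambda>n. real n * ln (real n)) \<in> O(\<lambda>n. real n powr (3/2))"
      by real_asymp
    \<comment> \<open>The exponents are 3/2, 2 and 2, against \<open>4/3 * 3/2 = 2\<close>: the last
      two terms are critical.\<close>
    have "cost \<in> O(\<lambda>k. real (dof Nt m k) powr (4/3))"
      using grids 2 by (intro cost_bigo_dof[OF assms(2) _ _ _ assms(4), where p = "3/2"])
        (auto intro: landau_o.big_trans nlogn)
    moreover have "memory \<in> O(\<lambda>k. real (dof Nt m k))"
      using grids 2 by (intro memory_bigo_dof[OF assms(2) _ _ assms(5)])
        (auto intro: landau_o.big_trans nlogn)
    ultimately show ?thesis
      using 2 by simp
  next
    case 3
    have pow: "(\<lambda>n. real n powr (4/3)) \<in> O(\<lambda>n. real n ^ 2)"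
      by real_asymp
    \<comment> \<open>The exponents are 1, 5/3 and 7/3, against \<open>7/4 * 4/3 = 7/3\<close>: only
      the spatial solves are critical.\<close>
    have "cost \<in> O(\<lambda>k. real (dof Nt m k) powr (7/4))"
      using grids 3 by (intro cost_bigo_dof[OF assms(2) _ _ _ assms(4), where p = 2])
        (auto intro: landau_o.big_trans pow)
    \<comment> \<open>The solver memory exponent 4/3 meets \<open>1 + 1/3\<close> exactly, without
      slack.\<close>
    moreover have "memory \<in> O(\<lambda>k. real (dof Nt m k))"
      using grids 3 by (intro memory_bigo_dof[OF assms(2) _ _ assms(5)]) auto
    ultimately show ?thesis
      using 3 by simp
  qed
qed

end
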